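(* For each integer $n\ge 1$, let $X_n$ be the number of occupied corners in a tree--like tableau chosen uniformly at random from the (finite) set of all tree--like tableaux of size $n$. Then, as $n\to\infty$, $X_n$ converges in distribution to a Poisson random variable with parameter $1$; that is, for every integer $k\ge 0$, $\lim_{n\to\infty}\mathbb{P}(X_n=k)=e^{-1}/k!$.
   Context: A Ferrers diagram is a left--aligned finite set of cells arranged in rows and columns with weakly decreasing numbers of cells in rows (from top to bottom). Its half--perimeter is the number of rows plus the number of columns. The border edges of a Ferrers diagram are the edges of its southeast border; their number equals the half--perimeter. A tree--like tableau of size $n$ is a Ferrers diagram of half--perimeter $n+1$ in which some cells (called pointed cells) are filled with a point, according to the following rules: (1) the cell in the first column and first row is pointed (this point is called the root point); (2) every row and every column contains at least one pointed cell; (3) for every pointed cell other than the root cell, either all the cells above it in the same column are empty (contain no point), or all the cells to its left in the same row are empty, but not both. A corner of a tree--like tableau is a cell whose right edge and bottom edge are both border edges. An occupied corner is a corner that contains a point. *)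

theory Defs
  imports "HOL-Probability.Probability"
begin

text \<open>
  A cell is a pair (row, column), both counted from 0; rows are numbered from top to bottom
  and columns from left to right.
\<close>

type_synonym cell = "nat \<times> nat"

definition row_length :: "cell set \<Rightarrow> nat \<Rightarrow> nat" where
  "row_length D i = card {j. (i, j) \<in> D}"

definition ferrers_diagram :: "cell set \<Rightarrow> bool" where
  "ferrers_diagram D \<longleftrightarrow>
     finite D \<and>
     (\<forall>i j j'. (i, j) \<in> D \<longrightarrow> j' < j \<longrightarrow> (i, j') \<in> D) \<and>
     (\<forall>i i'. i \<le> i' \<longrightarrow> row_length D i' \<le> row_length D i)"

text \<open>
  The rows and columns of a diagram are its nonempty ones. Nothing is lost by this: an empty row
  or column could not satisfy the condition that every row and column contains a point.
\<close>

definition diagram_rows :: "cell set \<Rightarrow> nat set" where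
  "diagram_rows D = fst ` D"

definition diagram_columns :: "cell set \<Rightarrow> nat set" where
  "diagram_columns D = snd ` D"

definition half_perimeter :: "cell set \<Rightarrow> nat" where
  "half_perimeter D = card (diagram_rows D) + card (diagram_columns D)"

text \<open>A tableau is a pair of a diagram and its set of pointed cells.\<close>

type_synonym tableau = "cell set \<times> cell set"

definition tree_like_tableau :: "nat \<Rightarrow> tableau \<Rightarrow> bool" where
  "tree_like_tableau n T \<longleftrightarrow> (case T of (D, P) \<Rightarrow>
     ferrers_diagram D \<and> half_perimeter D = n + 1 \<and> P \<subseteq> D \<and>
     (0, 0) \<in> P \<and>
     (\<forall>i\<in>diagram_rows D. \<exists>j. (i, j) \<in> P) \<and>
     (\<forall>j\<in>diagram_columns D. \<exists>i. (i, j) \<in> P) \<and>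
     (\<forall>i j. (i, j) \<in> P \<longrightarrow> (i, j) \<noteq> (0, 0) \<longrightarrow>
        ((\<forall>i'<i. (i', j) \<notin> P) \<or> (\<forall>j'<j. (i, j') \<notin> P)) \<and>
        \<not> ((\<forall>i'<i. (i', j) \<notin> P) \<and> (\<forall>j'<j. (i, j') \<notin> P))))"

definition tree_like_tableaux :: "nat \<Rightarrow> tableau set" where
  "tree_like_tableaux n = {T. tree_like_tableau n T}"

text \<open>
  The right (bottom) edge of a cell of the diagram lies on the southeast border iff there is no
  cell of the diagram on the other side of that edge.
\<close>

definition right_edge_on_border :: "cell set \<Rightarrow> cell \<Rightarrow> bool" where
  "right_edge_on_border D c \<longleftrightarrow> c \<in> D \<and> (fst c, Suc (snd c)) \<notin> D"

definition bottom_edge_on_border :: "cell set \<Rightarrow> cell \<Rightarrow> bool" where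
  "bottom_edge_on_border D c \<longleftrightarrow> c \<in> D \<and> (Suc (fst c), snd c) \<notin> D"

definition corners :: "cell set \<Rightarrow> cell set" where
  "corners D = {c \<in> D. right_edge_on_border D c \<and> bottom_edge_on_border D c}"

definition occupied_corners :: "tableau \<Rightarrow> nat" where
  "occupied_corners T = card (corners (fst T) \<inter> snd T)"

definition random_tlt :: "nat \<Rightarrow> tableau pmf" where
  "random_tlt n = pmf_of_set (tree_like_tableaux n)"

text \<open>
  The uniform distribution is well defined for all \<open>n \<ge> 1\<close>. (For \<open>n = 0\<close> there are no tableaux,
  so \<open>random_tlt 0\<close> is unspecified; this does not affect limits.)
\<close>

lemma ferrers_rows_initial:
  assumes "ferrers_diagram D" "(i, j) \<in> D" "i' \<le> i"
  shows "i' \<in> diagram_rows D"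
proof -
  have fin: "finite {j. (i, j) \<in> D}" for i
  proof (rule finite_subset)
    show "{j. (i, j) \<in> D} \<subseteq> snd ` D" by force
    show "finite (snd ` D)" using assms(1) by (simp add: ferrers_diagram_def)
  qed
  have "row_length D i > 0"
    unfolding row_length_def using fin assms(2) by (auto simp: card_gt_0_iff)
  hence "row_length D i' > 0"
    using assms unfolding ferrers_diagram_def by (meson less_le_trans)
  hence "{j. (i', j) \<in> D} \<noteq> {}"
    unfolding row_length_def by (metis card.empty less_irrefl)
  thus ?thesis unfolding diagram_rows_def by force
qed

lemma ferrers_bounded:
  assumes "ferrers_diagram D" "half_perimeter D = n + 1"
  shows "D \<subseteq> {..n} \<times> {..n}"
proof
  fix c assume c: "c \<in> D"
  obtain i j where ij: "c = (i, j)" by (cases c)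
  have fin: "finite (diagram_rows D)" "finite (diagram_columns D)"
    using assms(1) by (auto simp: ferrers_diagram_def diagram_rows_def diagram_columns_def)
  have "{..i} \<subseteq> diagram_rows D"
    using ferrers_rows_initial[OF assms(1)] c ij by blast
  hence "Suc i \<le> card (diagram_rows D)"
    using card_mono[OF fin(1), of "{..i}"] by simp
  moreover have "j' \<in> diagram_columns D" if "j' \<le> j" for j'
  proof -
    have "(i, j') \<in> D"
      using that assms(1) c ij unfolding ferrers_diagram_def by (metis le_neq_implies_less)
    thus ?thesis unfolding diagram_columns_def by force
  qed
  hence "{..j} \<subseteq> diagram_columns D" by blast
  hence "Suc j \<le> card (diagram_columns D)"
    using card_mono[OF fin(2), of "{..j}"] by simp
  ultimately show "c \<in> {..n} \<times> {..n}"
    using assms(2) ij by (simp add: half_perimeter_def)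
qed

lemma finite_tree_like_tableaux: "finite (tree_like_tableaux n)"
proof (rule finite_subset)
  show "tree_like_tableaux n \<subseteq> Pow ({..n} \<times> {..n}) \<times> Pow ({..n} \<times> {..n})"
  proof
    fix T assume T: "T \<in> tree_like_tableaux n"
    obtain D P where DP: "T = (D, P)" by (cases T)
    have "ferrers_diagram D" "half_perimeter D = n + 1" "P \<subseteq> D"
      using T unfolding DP tree_like_tableaux_def tree_like_tableau_def by simp_all
    thus "T \<in> Pow ({..n} \<times> {..n}) \<times> Pow ({..n} \<times> {..n})"
      using ferrers_bounded[of D n] unfolding DP by blast
  qed
qed simp

lemma tree_like_tableaux_nonempty:
  assumes "n \<ge> 1"
  shows "tree_like_tableaux n \<noteq> {}"
proof -
  let ?D = "{0} \<times> {..<n} :: cell set"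
  have row: "row_length ?D i = (if i = 0 then n else 0)" for i
    by (auto simp: row_length_def lessThan_def[symmetric])
  have ferrers: "ferrers_diagram ?D"
    unfolding ferrers_diagram_def row by auto
  have rows: "diagram_rows ?D = {0}" and cols: "diagram_columns ?D = {..<n}"
    using assms by (simp_all add: diagram_rows_def diagram_columns_def lessThan_empty_iff)
  have hp: "half_perimeter ?D = n + 1"
    unfolding half_perimeter_def rows cols by simp
  have "tree_like_tableau n (?D, ?D)"
    unfolding tree_like_tableau_def prod.case rows cols
    using assms ferrers hp by (auto intro: exI[of _ 0])
  thus ?thesis by (auto simp: tree_like_tableaux_def)
qed

end

theory Submission
  imports Defs
begin

text \<open>
  The proof computes the binomial moments \<open>E (X\<^sub>n choose k)\<close> by a recursion that removes one occupied
  corner at a time.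

  A corner is the last cell of its row and of its column. So by rule (3) the point of an occupied
  corner other than the root cell is the only point of its column or the only point of its row, but
  not both, and this line can be deleted; what remains is a tree-like tableau of size smaller by one.
  Conversely, at every border edge a line ending in a new occupied corner can be inserted: a column at
  the right edge of the last cell of a row, a row at the bottom edge of the last cell of a column.
  Hence tableaux of size \<open>n + 1\<close> with a marked occupied corner correspond to tableaux of size \<open>n\<close>
  with a marked border edge. If the smaller tableau has \<open>x\<close> occupied corners, then \<open>2 x\<close> of its
  \<open>n + 1\<close> border edges belong to one of them. Inserting at such an edge destroys that corner, so the
  number stays \<open>x\<close>; at each of the other edges it becomes \<open>x + 1\<close>. This gives
  \<open>sum_occupied_recurrence\<close>: for every function \<open>f\<close>, the sum of \<open>X f(X)\<close> over size \<open>n + 1\<close> equals the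
  sum of \<open>2 X f(X) + (n + 1 - 2 X) f(X + 1)\<close> over size \<open>n\<close>.

  To turn sums into averages the number of tableaux is needed, and it comes out of the same recursion
  with \<open>f = 1\<close>, once the average of \<open>X\<^sub>n\<close> is known to be exactly one. That holds because every diagram has
  one corner more than it has inner corners (cells whose addition creates a corner but no new row or
  column), while adding or removing an empty cell matches inner corners with empty corners
  (\<open>sum_occupied_eq_card\<close>).

  Taking \<open>f x = (x - 1 choose k)\<close> then yields
  \<open>E (X\<^sub>n\<^sub>+\<^sub>1 choose k + 1) = (n + 1 - 2 k) / ((n + 1) (k + 1)) E (X\<^sub>n choose k)\<close>
  (\<open>binomial_moment_Suc\<close>). So the \<open>k\<close>-th binomial moment tends to \<open>1 / k!\<close>, that of the Poisson
  distribution, and never exceeds it. This bound permits passing to the limit termwise in the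
  inclusion-exclusion series for \<open>P (X\<^sub>n = k)\<close> (\<open>binomial_moments_imp_poisson_limit\<close>), and pointwise
  convergence of the probabilities implies convergence in distribution.
\<close>

section \<open>Tree-like tableaux and transposition\<close>

definition transpose_tableau :: "tableau \<Rightarrow> tableau" where
  "transpose_tableau T = (prod.swap ` fst T, prod.swap ` snd T)"

text \<open>
  For finite sets of cells this is equivalent to being a Ferrers diagram, and unlike the definition by
  row lengths it is visibly symmetric in rows and columns.
\<close>

definition down_closed :: "cell set \<Rightarrow> bool" where
  "down_closed D \<longleftrightarrow> (\<forall>i j i' j'. (i, j) \<in> D \<longrightarrow> i' \<le> i \<longrightarrow> j' \<le> j \<longrightarrow> (i', j') \<in> D)"

lemma down_closedD: "down_closed D \<Longrightarrow> (i, j) \<in> D \<Longrightarrow> i' \<le> i \<Longrightarrow> j' \<le> j \<Longrightarrow> (i', j') \<in> D"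
  unfolding down_closed_def by blast

lemma finite_row:
  assumes "finite D"
  shows "finite {j. (i, j) \<in> (D :: cell set)}"
  by (rule finite_subset[of _ "snd ` D"]) (use assms in force)+

lemma initial_segment_eq_lessThan_card:
  fixes A :: "nat set"
  assumes "finite A" "\<And>a b. a \<in> A \<Longrightarrow> b \<le> a \<Longrightarrow> b \<in> A"
  shows "A = {..<card A}"
proof (cases "A = {}")
  case False
  have "A = {..Max A}"
    using assms False by (auto intro: Max_in)
  thus ?thesis by (metis card_atMost lessThan_Suc_atMost)
qed simp

lemma row_eq_lessThan:
  assumes "finite D" "\<And>j j'. (i, j) \<in> D \<Longrightarrow> j' < j \<Longrightarrow> (i, j') \<in> D"
  shows "(i, j) \<in> D \<longleftrightarrow> j < row_length D i"
proof -
  have "{j. (i, j) \<in> D} = {..<row_length D i}"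
    unfolding row_length_def
    by (rule initial_segment_eq_lessThan_card)
       (use assms finite_row in \<open>auto simp: le_less\<close>)
  thus ?thesis by blast
qed

lemma ferrers_diagram_iff_down_closed: "ferrers_diagram D \<longleftrightarrow> finite D \<and> down_closed D"
proof
  assume F: "ferrers_diagram D"
  have mem: "(i, j) \<in> D \<longleftrightarrow> j < row_length D i" for i j
    by (rule row_eq_lessThan) (use F in \<open>auto simp: ferrers_diagram_def\<close>)
  show "finite D \<and> down_closed D"
    using F unfolding down_closed_def mem ferrers_diagram_def by (meson order.strict_trans1 order.strict_trans2)
next
  assume F: "finite D \<and> down_closed D"
  have "row_length D i' \<le> row_length D i" if "i \<le> i'" for i i'
    unfolding row_length_def
    by (rule card_mono) (use F that in \<open>auto intro: finite_row down_closedD\<close>)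
  thus "ferrers_diagram D"
    unfolding ferrers_diagram_def using F by (auto intro: down_closedD)
qed

lemma mem_iff_less_row_length:
  assumes "finite D" "down_closed D"
  shows "(i, j) \<in> D \<longleftrightarrow> j < row_length D i"
  by (rule row_eq_lessThan) (use assms in \<open>auto intro: down_closedD\<close>)

lemma row_length_antimono:
  "finite D \<Longrightarrow> down_closed D \<Longrightarrow> i \<le> i' \<Longrightarrow> row_length D i' \<le> row_length D i"
  using ferrers_diagram_iff_down_closed[of D] unfolding ferrers_diagram_def by blast

lemma diagram_rows_eq: "down_closed D \<Longrightarrow> diagram_rows D = {i. (i, 0) \<in> D}"
  unfolding diagram_rows_def by (force intro: down_closedD)

lemma diagram_columns_eq: "down_closed D \<Longrightarrow> diagram_columns D = {j. (0, j) \<in> D}"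
  unfolding diagram_columns_def by (force intro: down_closedD)

definition empty_above :: "cell set \<Rightarrow> cell \<Rightarrow> bool" where
  "empty_above P c \<longleftrightarrow> (\<forall>i'<fst c. (i', snd c) \<notin> P)"

definition empty_left :: "cell set \<Rightarrow> cell \<Rightarrow> bool" where
  "empty_left P c \<longleftrightarrow> (\<forall>j'<snd c. (fst c, j') \<notin> P)"

text \<open>
  A restatement of the definition in which the symmetry between rows and columns is apparent and
  membership in a row or column is tested in the first column or row.
\<close>

lemma tree_like_tableau_iff:
  "tree_like_tableau n (D, P) \<longleftrightarrow>
     finite D \<and> down_closed D \<and> half_perimeter D = n + 1 \<and> P \<subseteq> D \<and> (0, 0) \<in> P \<and>
     (\<forall>i. (i, 0) \<in> D \<longrightarrow> (\<exists>j. (i, j) \<in> P)) \<and>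
     (\<forall>j. (0, j) \<in> D \<longrightarrow> (\<exists>i. (i, j) \<in> P)) \<and>
     (\<forall>i j. (i, j) \<in> P \<longrightarrow> (i, j) \<noteq> (0, 0) \<longrightarrow> empty_above P (i, j) \<noteq> empty_left P (i, j))"
proof -
  have exactly_one: "(A \<or> B) \<and> \<not> (A \<and> B) \<longleftrightarrow> A \<noteq> B" for A B :: bool by blast
  show ?thesis
    unfolding tree_like_tableau_def prod.case ferrers_diagram_iff_down_closed
      empty_above_def empty_left_def fst_conv snd_conv exactly_one
    by (cases "down_closed D") (simp_all add: diagram_rows_eq diagram_columns_eq)
qed

lemma mem_corners_iff: "(i, j) \<in> corners D \<longleftrightarrow> (i, j) \<in> D \<and> (i, Suc j) \<notin> D \<and> (Suc i, j) \<notin> D"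
  by (auto simp: corners_def right_edge_on_border_def bottom_edge_on_border_def)

lemma swap_image_mem: "(i, j) \<in> prod.swap ` S \<longleftrightarrow> (j, i) \<in> S"
  by force

lemma down_closed_swap: "down_closed (prod.swap ` D) \<longleftrightarrow> down_closed D"
  unfolding down_closed_def swap_image_mem by blast

lemma half_perimeter_swap: "half_perimeter (prod.swap ` D) = half_perimeter D"
  unfolding half_perimeter_def diagram_rows_def diagram_columns_def image_image by simp

lemma empty_above_swap: "empty_above (prod.swap ` P) c = empty_left P (prod.swap c)"
  and empty_left_swap: "empty_left (prod.swap ` P) c = empty_above P (prod.swap c)"
  by (simp_all add: empty_above_def empty_left_def swap_image_mem)

lemma transpose_transpose [simp]: "transpose_tableau (transpose_tableau T) = T"
  by (simp add: transpose_tableau_def image_image)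

text \<open>
  By this symmetry, only occupied corners that hold the single point of their column have to be
  studied.
\<close>

lemma tree_like_tableau_transpose:
  assumes "tree_like_tableau n T"
  shows "tree_like_tableau n (transpose_tableau T)"
proof -
  obtain D P where T: "T = (D, P)" by (cases T)
  note * = assms[unfolded T tree_like_tableau_iff]
  have "tree_like_tableau n (prod.swap ` D, prod.swap ` P)"
    unfolding tree_like_tableau_iff down_closed_swap half_perimeter_swap
      empty_above_swap empty_left_swap swap_image_mem swap_simp
    using * by (intro conjI; (simp add: image_mono; fail)?)
  thus ?thesis by (simp add: T transpose_tableau_def)
qed

lemma corners_swap: "corners (prod.swap ` D) = prod.swap ` corners D"
proof (rule set_eqI)
  fix c :: cell
  show "c \<in> corners (prod.swap ` D) \<longleftrightarrow> c \<in> prod.swap ` corners D"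
    by (cases c) (auto simp: swap_image_mem mem_corners_iff)
qed

definition occupied :: "tableau \<Rightarrow> cell set" where
  "occupied T = corners (fst T) \<inter> snd T"

lemma occupied_transpose: "occupied (transpose_tableau T) = prod.swap ` occupied T"
  by (simp add: occupied_def transpose_tableau_def corners_swap image_Int[OF inj_swap])

section \<open>Insertion of a column ending in an occupied corner\<close>

definition insert_column :: "nat \<Rightarrow> nat set \<Rightarrow> cell set \<Rightarrow> cell set" where
  "insert_column j A S =
     {(a, b). if b < j then (a, b) \<in> S else if b = j then a \<in> A else (a, b - 1) \<in> S}"

definition delete_column :: "nat \<Rightarrow> cell set \<Rightarrow> cell set" where
  "delete_column j S = {(a, b). (a, if b < j then b else Suc b) \<in> S}"

lemma mem_insert_column [simp]:
  "b < j \<Longrightarrow> (a, b) \<in> insert_column j A S \<longleftrightarrow> (a, b) \<in> S"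
  "(a, j) \<in> insert_column j A S \<longleftrightarrow> a \<in> A"
  "j \<le> b \<Longrightarrow> (a, Suc b) \<in> insert_column j A S \<longleftrightarrow> (a, b) \<in> S"
  by (auto simp: insert_column_def)

lemma column_cases:
  obtains "b < j" | "b = j" | c where "b = Suc c" "j \<le> (c :: nat)"
  by (metis less_Suc_eq_le linorder_neqE_nat Suc_less_eq2 not_less_eq lessE less_imp_le_nat)

lemma insert_delete_column: "insert_column j {a. (a, j) \<in> S} (delete_column j S) = S"
proof (rule set_eqI)
  fix c :: cell
  obtain a b where "c = (a, b)" by (cases c)
  thus "c \<in> insert_column j {a. (a, j) \<in> S} (delete_column j S) \<longleftrightarrow> c \<in> S"
    by (cases b j rule: column_cases) (auto simp: delete_column_def)
qed

lemma delete_insert_column [simp]: "delete_column j (insert_column j A S) = S"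
  by (auto simp: insert_column_def delete_column_def split: if_splits)

lemma empty_above_insert_column [simp]:
  "b < j \<Longrightarrow> empty_above (insert_column j A S) (a, b) = empty_above S (a, b)"
  "j \<le> b \<Longrightarrow> empty_above (insert_column j A S) (a, Suc b) = empty_above S (a, b)"
  by (auto simp: empty_above_def)

text \<open>
  To the right of the new column, nothing changes in the rows where the new column has no point.
\<close>

lemma empty_left_insert_column:
  "b < j \<Longrightarrow> empty_left (insert_column j A S) (a, b) = empty_left S (a, b)"
  "j \<le> b \<Longrightarrow> a \<notin> A \<Longrightarrow> empty_left (insert_column j A S) (a, Suc b) = empty_left S (a, b)"
proof -
  show "b < j \<Longrightarrow> empty_left (insert_column j A S) (a, b) = empty_left S (a, b)"
    by (auto simp: empty_left_def)
next
  assume *: "j \<le> b" "a \<notin> A"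
  show "empty_left (insert_column j A S) (a, Suc b) = empty_left S (a, b)"
  proof
    assume L: "empty_left (insert_column j A S) (a, Suc b)"
    have "(a, b') \<notin> S" if "b' < b" for b'
      using L that unfolding empty_left_def
      by (cases "b' < j") (auto dest: spec[of _ b'] spec[of _ "Suc b'"])
    thus "empty_left S (a, b)" by (simp add: empty_left_def)
  next
    assume R: "empty_left S (a, b)"
    have "(a, b') \<notin> insert_column j A S" if "b' < Suc b" for b'
      by (cases b' j rule: column_cases) (use R that * in \<open>auto simp: empty_left_def\<close>)
    thus "empty_left (insert_column j A S) (a, Suc b)" by (simp add: empty_left_def)
  qed
qed

lemma row_length_of_profile: "row_length {(a, b). b < f a} i = f i"
  by (simp add: row_length_def lessThan_def[symmetric])

lemma down_closed_of_profile:
  fixes f :: "nat \<Rightarrow> nat"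
  shows "antimono f \<Longrightarrow> down_closed {(a, b). b < f a}"
  unfolding down_closed_def by (auto intro: order.strict_trans2 order.strict_trans1 antimonoD)

text \<open>
  If the new column reaches down to row \<open>i\<close> and stands just behind the last cell of that row, then the
  diagram grows by one cell in each of the rows up to \<open>i\<close>; all those rows are at least as long as
  row \<open>i\<close>, and the rows below are not longer, so they are not affected.
\<close>

lemma insert_column_profile:
  assumes "finite D" "down_closed D"
  shows "insert_column (row_length D i) {..i} D
       = {(a, b). b < (if a \<le> i then Suc (row_length D a) else row_length D a)}" (is "?L = ?R")
proof (rule set_eqI)
  fix c :: cell
  obtain a b where c: "c = (a, b)" by (cases c)
  note mem = mem_iff_less_row_length[OF assms]
  have "a \<le> i \<Longrightarrow> row_length D i \<le> row_length D a"
    and "\<not> a \<le> i \<Longrightarrow> row_length D a \<le> row_length D i"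
    using row_length_antimono[OF assms] by auto
  thus "c \<in> ?L \<longleftrightarrow> c \<in> ?R"
    unfolding c by (cases b "row_length D i" rule: column_cases) (auto simp: mem)
qed

lemma half_perimeter_profile:
  assumes "finite D" "down_closed D"
  shows "half_perimeter D = card {i. (i, 0) \<in> D} + row_length D 0"
  using assms by (simp add: half_perimeter_def diagram_rows_eq diagram_columns_eq row_length_def)

lemma insert_column_diagram:
  assumes D: "finite D" "down_closed D" "(i, 0) \<in> D"
  defines "E \<equiv> insert_column (row_length D i) {..i} D"
  shows "finite E" "down_closed E" "half_perimeter E = Suc (half_perimeter D)"
    "\<And>a. (a, 0) \<in> E \<longleftrightarrow> (a, 0) \<in> D"
proof -
  let ?f = "\<lambda>a. if a \<le> i then Suc (row_length D a) else row_length D a"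
  have E: "E = {(a, b). b < ?f a}"
    unfolding E_def by (rule insert_column_profile) fact+
  note mem = mem_iff_less_row_length[OF D(1,2)]
  have pos: "0 < row_length D i" using D(3) mem by simp
  show rows: "(a, 0) \<in> E \<longleftrightarrow> (a, 0) \<in> D" for a
    using pos unfolding E_def by simp
  have anti: "antimono ?f"
    using row_length_antimono[OF D(1,2)] by (auto intro!: antimonoI simp: le_SucI)
  show dc: "down_closed E" unfolding E by (rule down_closed_of_profile[OF anti])
  show fin: "finite E"
  proof (rule finite_subset)
    show "E \<subseteq> diagram_rows D \<times> {..<?f 0}"
    proof
      fix c assume "c \<in> E"
      then obtain a b where c: "c = (a, b)" "(a, b) \<in> E" by (cases c) auto
      have "(a, 0) \<in> D" using rows c(2) down_closedD[OF dc, of a b a 0] by simp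
      moreover have "b < ?f 0" using c(2) antimonoD[OF anti, of 0 a] unfolding E by simp
      ultimately show "c \<in> diagram_rows D \<times> {..<?f 0}"
        using c(1) by (force simp: diagram_rows_def)
    qed
    show "finite (diagram_rows D \<times> {..<?f 0})"
      using D(1) by (simp add: diagram_rows_def)
  qed
  have "row_length E 0 = Suc (row_length D 0)"
    unfolding E row_length_of_profile by simp
  thus "half_perimeter E = Suc (half_perimeter D)"
    using half_perimeter_profile[OF fin dc] half_perimeter_profile[OF D(1,2)] rows by simp
qed

text \<open>
  The heart of the bijection. The new point has no point above it, so rule (3) asks for a point to its
  left, and such a point exists exactly if row \<open>i\<close> contained a point before. For the other points rule (3)
  says the same as before: those to the right of the new column lie in rows strictly above row \<open>i\<close>,
  where the new column is empty. The equivalence serves both directions of the bijection.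
\<close>

lemma tree_like_insert_column_iff:
  assumes D: "finite D" "down_closed D" "(i, 0) \<in> D"
  defines "r \<equiv> row_length D i"
  shows "tree_like_tableau (Suc n) (insert_column r {..i} D, insert_column r {i} P)
     \<longleftrightarrow> tree_like_tableau n (D, P)"
proof -
  let ?E = "insert_column r {..i} D" and ?Q = "insert_column r {i} P"
  note mem = mem_iff_less_row_length[OF D(1,2)]
  have r: "0 < r" using D(3) mem by (simp add: r_def)
  note E = insert_column_diagram[OF D, folded r_def]
  have sub: "?Q \<subseteq> ?E \<longleftrightarrow> P \<subseteq> D"
  proof
    assume *: "?Q \<subseteq> ?E"
    have "(a, b) \<in> D" if "(a, b) \<in> P" for a b
      using subsetD[OF *, of "(a, b)"] subsetD[OF *, of "(a, Suc b)"] that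
      by (cases "b < r") auto
    thus "P \<subseteq> D" by auto
  next
    assume *: "P \<subseteq> D"
    have "(a, b) \<in> ?E" if "(a, b) \<in> ?Q" for a b
      by (cases b r rule: column_cases) (use that * in auto)
    thus "?Q \<subseteq> ?E" by auto
  qed
  have rows: "(\<exists>b. (a, b) \<in> ?Q) \<longleftrightarrow> a = i \<or> (\<exists>b. (a, b) \<in> P)" for a
  proof
    assume "\<exists>b. (a, b) \<in> ?Q"
    then obtain b where "(a, b) \<in> ?Q" ..
    thus "a = i \<or> (\<exists>b. (a, b) \<in> P)" by (cases b r rule: column_cases) auto
  next
    assume "a = i \<or> (\<exists>b. (a, b) \<in> P)"
    thus "\<exists>b. (a, b) \<in> ?Q"
    proof
      assume "a = i"
      thus ?thesis by (intro exI[of _ r]) simp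
    next
      assume "\<exists>b. (a, b) \<in> P"
      then obtain b where b: "(a, b) \<in> P" ..
      show ?thesis
        by (rule exI[of _ "if b < r then b else Suc b"]) (use b in simp)
    qed
  qed
  have cols: "(\<forall>b. (0, b) \<in> ?E \<longrightarrow> (\<exists>a. (a, b) \<in> ?Q)) \<longleftrightarrow> (\<forall>b. (0, b) \<in> D \<longrightarrow> (\<exists>a. (a, b) \<in> P))"
  proof (intro iffI allI impI)
    fix b assume *: "\<forall>b. (0, b) \<in> ?E \<longrightarrow> (\<exists>a. (a, b) \<in> ?Q)" and b: "(0, b) \<in> D"
    show "\<exists>a. (a, b) \<in> P"
      using spec[OF *, of b] spec[OF *, of "Suc b"] b by (cases "b < r") auto
  next
    fix b assume *: "\<forall>b. (0, b) \<in> D \<longrightarrow> (\<exists>a. (a, b) \<in> P)" and b: "(0, b) \<in> ?E"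
    show "\<exists>a. (a, b) \<in> ?Q"
      by (cases b r rule: column_cases) (use b * in auto)
  qed
  have right: "a < i" if "(a, b) \<in> D" "r \<le> b" for a b
  proof (rule ccontr)
    assume "\<not> a < i"
    hence "row_length D a \<le> r" using row_length_antimono[OF D(1,2)] by (simp add: r_def)
    thus False using that mem by simp
  qed
  have new_left: "empty_left ?Q (i, r) \<longleftrightarrow> (\<nexists>b. (i, b) \<in> P)" if "P \<subseteq> D"
  proof -
    have "b < r" if "(i, b) \<in> P" for b
      using that \<open>P \<subseteq> D\<close> mem r_def by auto
    thus ?thesis unfolding empty_left_def by auto
  qed
  have new_above: "empty_above ?Q (i, r)"
    unfolding empty_above_def by auto
  let ?cond = "\<lambda>P a b. (a, b) \<in> P \<longrightarrow> (a, b) \<noteq> (0, 0) \<longrightarrow> empty_above P (a, b) \<noteq> empty_left P (a, b)"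
  have cond: "(\<forall>a b. ?cond ?Q a b) \<longleftrightarrow> (\<forall>a b. ?cond P a b) \<and> (\<exists>b. (i, b) \<in> P)" if sub: "P \<subseteq> D"
  proof -
    have low: "?cond ?Q a b \<longleftrightarrow> ?cond P a b" if "b < r" for a b
      using that by (simp add: empty_left_insert_column)
    have high: "?cond ?Q a (Suc b) \<longleftrightarrow> ?cond P a b" if "r \<le> b" for a b
    proof (cases "(a, b) \<in> P")
      case True
      hence "a \<noteq> i" using right[of a b] that sub by auto
      thus ?thesis using that r by (simp add: empty_left_insert_column)
    qed (use that in simp)
    have new: "?cond ?Q a r \<longleftrightarrow> (a = i \<longrightarrow> (\<exists>b. (i, b) \<in> P))" for a
      using new_left[OF sub] new_above r by auto
    show ?thesis
    proof (intro iffI conjI allI)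
      fix a b assume *: "\<forall>a b. ?cond ?Q a b"
      show "?cond P a b"
      proof (cases "b < r")
        case True
        thus ?thesis using * low by blast
      next
        case False
        hence "r \<le> b" by simp
        thus ?thesis using * high by blast
      qed
    next
      assume *: "\<forall>a b. ?cond ?Q a b"
      show "\<exists>b. (i, b) \<in> P" using * new by blast
    next
      fix a b assume *: "(\<forall>a b. ?cond P a b) \<and> (\<exists>b. (i, b) \<in> P)"
      show "?cond ?Q a b"
      proof (cases b r rule: column_cases)
        case 1
        thus ?thesis using * low by blast
      next
        case 2
        thus ?thesis using * new by blast
      next
        case (3 c)
        thus ?thesis using * high by blast
      qed
    qed
  qed
  show ?thesis
    unfolding tree_like_tableau_iff E(3,4) sub rows cols
    using cond E(1,2) D r by auto
qed

text \<open>
  Insertion at the right edge of the last cell of row \<open>i\<close>: the new column ends in a new occupied corner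
  in row \<open>i\<close>.
\<close>

definition insert_point :: "nat \<Rightarrow> tableau \<Rightarrow> tableau" where
  "insert_point i T = (insert_column (row_length (fst T) i) {..i} (fst T),
                       insert_column (row_length (fst T) i) {i} (snd T))"

definition remove_point :: "cell \<Rightarrow> tableau \<Rightarrow> tableau" where
  "remove_point c T = (delete_column (snd c) (fst T), delete_column (snd c) (snd T))"

text \<open>
  A corner ends its column. So if there is no point above it, its point is the only one in the column.
\<close>

definition column_corners :: "tableau \<Rightarrow> cell set" where
  "column_corners T = {c \<in> occupied T. empty_above (snd T) c}"

lemma tree_like_insert_point:
  assumes T: "tree_like_tableau n T" and i: "i \<in> diagram_rows (fst T)"
  shows "tree_like_tableau (Suc n) (insert_point i T)"
proof -
  obtain D P where DP: "T = (D, P)" by (cases T)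
  have D: "finite D" "down_closed D" using T unfolding DP tree_like_tableau_iff by auto
  hence "(i, 0) \<in> D" using i DP by (simp add: diagram_rows_eq)
  thus ?thesis
    using tree_like_insert_column_iff[OF D] T unfolding DP insert_point_def by simp
qed

lemma remove_insert_point: "remove_point (i, row_length (fst T) i) (insert_point i T) = T"
  by (simp add: remove_point_def insert_point_def)

text \<open>
  For \<open>n = 0\<close> the only corner is the root cell, and its removal would leave nothing. In all other
  cases the corner is not the root, so there is a point to its left; this keeps the row and the root
  point intact when the column of the corner is deleted.
\<close>

lemma remove_point:
  assumes T: "tree_like_tableau (Suc n) T" and n: "1 \<le> n" and c: "(i, j) \<in> column_corners T"
  defines "T' \<equiv> remove_point (i, j) T"
  shows "tree_like_tableau n T'" "i \<in> diagram_rows (fst T')" "row_length (fst T') i = j"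
    "insert_point i T' = T"
proof -
  obtain D P where DP: "T = (D, P)" by (cases T)
  note T = T[unfolded DP]
  note T' = T[unfolded tree_like_tableau_iff]
  have D: "finite D" "down_closed D" "P \<subseteq> D" using T' by blast+
  note mem = mem_iff_less_row_length[OF D(1,2)]
  note anti = row_length_antimono[OF D(1,2)]
  have c: "(i, j) \<in> P" "j < row_length D i" "row_length D i \<le> Suc j" "row_length D (Suc i) \<le> j"
    "empty_above P (i, j)"
    using c unfolding column_corners_def occupied_def DP by (auto simp: mem_corners_iff mem)
  have ri: "row_length D i = Suc j" using c by simp
  have "(i, j) \<noteq> (0, 0)"
  proof
    assume ij: "(i, j) = (0, 0)"
    have "{i. (i, 0) \<in> D} = {0}"
    proof -
      have "a = 0" if "0 < row_length D a" for a
        using anti[of "Suc 0" a] c(4) that ij by (cases a) auto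
      moreover have "0 < row_length D 0" using c(2) ij by simp
      ultimately show ?thesis by (auto simp: mem)
    qed
    thus False
      using half_perimeter_profile[OF D(1,2)] T' ri ij n by simp
  qed
  hence "\<not> empty_left P (i, j)" using T' c(1,5) by blast
  then obtain j' where j': "j' < j" "(i, j') \<in> P" by (auto simp: empty_left_def)
  hence j: "0 < j" by simp
  define D0 where "D0 = delete_column j D"
  define P0 where "P0 = delete_column j P"
  let ?f = "\<lambda>a. if a \<le> i then row_length D a - 1 else row_length D a"
  have big: "a \<le> i \<Longrightarrow> Suc j \<le> row_length D a" and small: "i < a \<Longrightarrow> row_length D a \<le> j" for a
    using anti[of a i] anti[of "Suc i" a] ri c(4) by auto
  have D0: "D0 = {(a, b). b < ?f a}"
  proof (rule set_eqI)
    fix c :: cell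
    obtain a b where ab: "c = (a, b)" by (cases c)
    show "c \<in> D0 \<longleftrightarrow> c \<in> {(a, b). b < ?f a}"
      using big[of a] small[of a] unfolding ab D0_def delete_column_def
      by (cases "a \<le> i") (auto simp: mem)
  qed
  have "antimono ?f"
  proof (rule antimonoI)
    fix a b :: nat assume "a \<le> b"
    thus "?f b \<le> ?f a" using anti[of a b] big[of a] small[of b] by auto
  qed
  hence D0_dc: "down_closed D0" unfolding D0 by (rule down_closed_of_profile)
  have D0_fin: "finite D0"
    by (rule finite_subset[OF _ D(1)]) (auto simp: D0 mem split: if_splits)
  have r0: "row_length D0 i = j" unfolding D0 row_length_of_profile using ri by simp
  have i0: "(i, 0) \<in> D0" using j ri by (simp add: D0)
  have "{a. (a, j) \<in> D} = {..i}"
    using big small by (force simp: mem not_less[symmetric])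
  hence DD: "insert_column j {..i} D0 = D"
    using insert_delete_column[of j D] by (simp add: D0_def)
  have "{a. (a, j) \<in> P} = {i}"
  proof -
    have "a = i" if "(a, j) \<in> P" for a
    proof -
      have "(a, j) \<in> D" using that D(3) by blast
      hence "a \<le> i" using small[of a] by (cases "a \<le> i") (auto simp: mem)
      moreover have "\<not> a < i" using that c(5) by (auto simp: empty_above_def)
      ultimately show ?thesis by simp
    qed
    thus ?thesis using c(1) by blast
  qed
  hence PP: "insert_column j {i} P0 = P"
    using insert_delete_column[of j P] by (simp add: P0_def)
  have T'_eq: "T' = (D0, P0)"
    by (simp add: T'_def remove_point_def DP D0_def P0_def)
  show "tree_like_tableau n T'"
    using tree_like_insert_column_iff[OF D0_fin D0_dc i0, of n P0] T unfolding r0 DD PP T'_eq by simp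
  show "i \<in> diagram_rows (fst T')" using i0 D0_dc by (simp add: T'_eq diagram_rows_eq)
  show "row_length (fst T') i = j" by (simp add: T'_eq r0)
  show "insert_point i T' = T" by (simp add: T'_eq insert_point_def r0 DD PP DP)
qed

text \<open>
  The insertion destroys at most one corner: the last cell of row \<open>i\<close>, whose right neighbour now belongs
  to the diagram. All other occupied corners survive, shifted if they lie to the right of the new
  column.
\<close>

lemma occupied_insert_point:
  assumes T: "tree_like_tableau n T" and i: "i \<in> diagram_rows (fst T)"
  defines "r \<equiv> row_length (fst T) i"
  shows "occupied (insert_point i T)
       = insert (i, r) (map_prod id (\<lambda>b. if b < r then b else Suc b) ` (occupied T - {(i, r - 1)}))"
    (is "?L = ?R")
proof -
  obtain D P where DP: "T = (D, P)" by (cases T)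
  have D: "finite D" "down_closed D" "P \<subseteq> D" using T unfolding DP tree_like_tableau_iff by auto
  note mem = mem_iff_less_row_length[OF D(1,2)]
  note anti = row_length_antimono[OF D(1,2)]
  define R where "R = row_length D"
  have r: "r = R i" by (simp add: r_def R_def DP)
  have "0 < r" using i D mem by (simp add: r_def DP diagram_rows_eq)
  let ?f = "\<lambda>a. if a \<le> i then Suc (R a) else R a"
  \<comment> \<open>both diagrams are described by their row lengths, which makes corners an arithmetic condition\<close>
  have L: "(a, b) \<in> ?L \<longleftrightarrow> Suc b = ?f a \<and> ?f (Suc a) \<le> b \<and> (a, b) \<in> insert_column r {i} P" for a b
    using insert_column_profile[OF D(1,2), of i]
    unfolding occupied_def insert_point_def DP fst_conv snd_conv R_def[symmetric] r[symmetric]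
    by (auto simp: mem_corners_iff)
  have occ: "(a, b) \<in> occupied T \<longleftrightarrow> Suc b = R a \<and> R (Suc a) \<le> b \<and> (a, b) \<in> P" for a b
    unfolding occupied_def DP by (auto simp: mem_corners_iff mem R_def)
  have shift: "(a, b) \<in> map_prod id (\<lambda>b. if b < r then b else Suc b) ` S
      \<longleftrightarrow> b < r \<and> (a, b) \<in> S \<or> (\<exists>c\<ge>r. b = Suc c \<and> (a, c) \<in> S)" for a b S
    by (force simp: map_prod_def image_iff split: if_splits)
  have anti: "a \<le> b \<Longrightarrow> R b \<le> R a" for a b using anti by (simp add: R_def)
  show ?thesis
  proof (rule set_eqI)
    fix c :: cell
    obtain a b where ab: "c = (a, b)" by (cases c)
    show "c \<in> ?L \<longleftrightarrow> c \<in> ?R"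
    proof (cases b r rule: column_cases)
      case 1
      have "(a, b) \<in> ?L \<longleftrightarrow> i < a \<and> (a, b) \<in> occupied T"
        unfolding L occ using 1 anti[of a i] r by auto
      also have "\<dots> \<longleftrightarrow> (a, b) \<in> occupied T - {(i, r - 1)}"
      proof -
        have "a = i \<and> b = r - 1" if "\<not> i < a" "(a, b) \<in> occupied T"
        proof -
          have "Suc b = R a" "R (Suc a) \<le> b" using that occ by auto
          thus ?thesis using that 1 r anti[of a i] anti[of "Suc a" i] by (cases "a = i") auto
        qed
        thus ?thesis using \<open>0 < r\<close> by (auto simp: occ r)
      qed
      finally show ?thesis using 1 unfolding ab by (auto simp: shift)
    next
      case 2
      have "(a, b) \<in> ?L \<longleftrightarrow> a = i"
        unfolding L 2 using r anti[of i "Suc i"] by (cases "a = i") auto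
      thus ?thesis using 2 unfolding ab by (auto simp: shift)
    next
      case (3 d)
      have "a < i" if "d < R a"
        using that 3 r anti[of i a] by (cases "a < i") auto
      hence "(a, b) \<in> ?L \<longleftrightarrow> (a, d) \<in> occupied T"
        unfolding L occ using 3 by auto
      moreover have "(a, d) \<noteq> (i, r - 1)" using 3 \<open>0 < r\<close> by auto
      ultimately show ?thesis using 3 unfolding ab by (auto simp: shift)
    qed
  qed
qed

lemma finite_occupied: "tree_like_tableau n T \<Longrightarrow> finite (occupied T)"
  by (cases T) (auto simp: tree_like_tableau_iff occupied_def intro: finite_subset)

lemma card_occupied_insert_point:
  assumes T: "tree_like_tableau n T" and i: "i \<in> diagram_rows (fst T)"
  defines "r \<equiv> row_length (fst T) i"
  shows "card (occupied (insert_point i T)) = Suc (card (occupied T - {(i, r - 1)}))"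
proof -
  let ?s = "map_prod id (\<lambda>b. if b < r then b else Suc b) :: cell \<Rightarrow> cell"
  have "inj ?s" by (auto intro!: prod.inj_map injI split: if_splits)
  hence "card (?s ` (occupied T - {(i, r - 1)})) = card (occupied T - {(i, r - 1)})"
    by (meson card_image inj_on_subset subset_UNIV)
  moreover have "(i, r) \<notin> ?s ` (occupied T - {(i, r - 1)})"
    by (auto split: if_splits)
  ultimately show ?thesis
    using occupied_insert_point[OF T i] finite_occupied[OF T] unfolding r_def by simp
qed

lemma insert_point_column_corner:
  assumes T: "tree_like_tableau n T" and i: "i \<in> diagram_rows (fst T)"
  shows "(i, row_length (fst T) i) \<in> column_corners (insert_point i T)"
  using occupied_insert_point[OF T i]
  by (auto simp: column_corners_def empty_above_def insert_point_def)

section \<open>The recursion for occupied corners\<close>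

lemma occupied_iff:
  assumes "tree_like_tableau n T" "(i, j) \<in> occupied T"
  shows "i \<in> diagram_rows (fst T)" "j = row_length (fst T) i - 1"
proof -
  obtain D P where T: "T = (D, P)" by (cases T)
  have D: "finite D" "down_closed D" using assms(1) unfolding T tree_like_tableau_iff by auto
  have "(i, j) \<in> corners D" using assms(2) by (simp add: occupied_def T)
  thus "i \<in> diagram_rows (fst T)" "j = row_length (fst T) i - 1"
    by (auto simp: T mem_corners_iff mem_iff_less_row_length[OF D] diagram_rows_eq[OF D(2)])
qed

lemma finite_diagram_rows: "tree_like_tableau n T \<Longrightarrow> finite (diagram_rows (fst T))"
  by (cases T) (auto simp: tree_like_tableau_iff diagram_rows_def)

text \<open>
  A row contains at most one corner, its last cell. So the rows at whose end an insertion destroys an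
  occupied corner are as many as the occupied corners.
\<close>

lemma occupied_rows:
  assumes "tree_like_tableau n T"
  shows "{i \<in> diagram_rows (fst T). (i, row_length (fst T) i - 1) \<in> occupied T} = fst ` occupied T"
    and "card (fst ` occupied T) = card (occupied T)"
    and "card (occupied T) \<le> card (diagram_rows (fst T))"
proof -
  show "{i \<in> diagram_rows (fst T). (i, row_length (fst T) i - 1) \<in> occupied T} = fst ` occupied T"
    using occupied_iff[OF assms] by force
  have "inj_on fst (occupied T)"
    by (rule inj_onI) (metis occupied_iff(2)[OF assms] prod.collapse)
  thus card: "card (fst ` occupied T) = card (occupied T)" by (rule card_image)
  have "fst ` occupied T \<subseteq> diagram_rows (fst T)"
    using occupied_iff[OF assms] by force
  thus "card (occupied T) \<le> card (diagram_rows (fst T))"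
    using card_mono[OF finite_diagram_rows[OF assms]] card by metis
qed

lemma sum_insert_point_rows:
  fixes f :: "nat \<Rightarrow> real"
  assumes T: "tree_like_tableau n T"
  defines "x \<equiv> card (occupied T)"
  shows "(\<Sum>i\<in>diagram_rows (fst T). f (card (occupied (insert_point i T))))
       = real x * f x + (real (card (diagram_rows (fst T))) - real x) * f (Suc x)"
proof -
  let ?rows = "diagram_rows (fst T)" and ?A = "fst ` occupied T"
  have fin: "finite ?rows" by (rule finite_diagram_rows[OF T])
  have sub: "?A \<subseteq> ?rows" using occupied_iff[OF T] by force
  have "(\<Sum>i\<in>?rows. f (card (occupied (insert_point i T))))
      = (\<Sum>i\<in>?rows. if i \<in> ?A then f x else f (Suc x))"
  proof (rule sum.cong[OF refl])
    fix i assume i: "i \<in> ?rows"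
    let ?c = "(i, row_length (fst T) i - 1)"
    have "i \<in> ?A \<longleftrightarrow> ?c \<in> occupied T"
      using i occupied_rows(1)[OF T] by blast
    moreover have "Suc (card (occupied T - {?c})) = x" if "?c \<in> occupied T"
      unfolding x_def using finite_occupied[OF T] that by (rule card_Suc_Diff1)
    moreover have "card (occupied T - {?c}) = x" if "?c \<notin> occupied T"
      using that by (simp add: x_def)
    ultimately show "f (card (occupied (insert_point i T))) = (if i \<in> ?A then f x else f (Suc x))"
      using card_occupied_insert_point[OF T i] by presburger
  qed
  also have "\<dots> = real (card ?A) * f x + real (card (?rows - ?A)) * f (Suc x)"
    using sub by (simp add: sum.If_cases[OF fin] Int_absorb1 Diff_eq)
  also have "real (card (?rows - ?A)) = real (card ?rows) - real (card ?A)"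
    using sub fin by (simp add: card_Diff_subset finite_subset card_mono of_nat_diff)
  finally show ?thesis unfolding occupied_rows(2)[OF T] x_def .
qed

lemma finite_column_corners: "tree_like_tableau n T \<Longrightarrow> finite (column_corners T)"
  using finite_occupied by (simp add: column_corners_def)

text \<open>
  Marked column corners of tableaux of size \<open>n + 1\<close> correspond to marked rows, that is, vertical border
  edges, of tableaux of size \<open>n\<close>.
\<close>

lemma sum_column_corners:
  fixes f :: "nat \<Rightarrow> real"
  assumes n: "1 \<le> n"
  shows "(\<Sum>T\<in>tree_like_tableaux (Suc n). real (card (column_corners T)) * f (card (occupied T)))
       = (\<Sum>T\<in>tree_like_tableaux n. real (card (occupied T)) * f (card (occupied T))
           + (real (card (diagram_rows (fst T))) - real (card (occupied T))) * f (Suc (card (occupied T))))"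
proof -
  have "(\<Sum>T\<in>tree_like_tableaux (Suc n). real (card (column_corners T)) * f (card (occupied T)))
      = (\<Sum>T\<in>tree_like_tableaux (Suc n). \<Sum>c\<in>column_corners T. f (card (occupied T)))"
    by simp
  also have "\<dots> = (\<Sum>(T, c)\<in>(SIGMA T:tree_like_tableaux (Suc n). column_corners T). f (card (occupied T)))"
    by (rule sum.Sigma)
       (use finite_tree_like_tableaux in \<open>auto simp: tree_like_tableaux_def intro: finite_column_corners\<close>)
  also have "\<dots> = (\<Sum>(T, i)\<in>(SIGMA T:tree_like_tableaux n. diagram_rows (fst T)).
                    f (card (occupied (insert_point i T))))"
    by (rule sum.reindex_bij_witness[where
          i = "\<lambda>(T, i). (insert_point i T, (i, row_length (fst T) i))" and
          j = "\<lambda>(T, c). (remove_point c T, fst c)"])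
       (auto simp: tree_like_tableaux_def remove_point[OF _ n] tree_like_insert_point
          remove_insert_point[where T = "(D, P)" for D P, unfolded fst_conv]
          insert_point_column_corner[where T = "(D, P)" for D P, unfolded fst_conv])
  also have "\<dots> = (\<Sum>T\<in>tree_like_tableaux n. \<Sum>i\<in>diagram_rows (fst T).
                    f (card (occupied (insert_point i T))))"
    by (rule sum.Sigma[symmetric])
       (use finite_tree_like_tableaux in \<open>auto simp: tree_like_tableaux_def
          intro: finite_diagram_rows[where T = "(D, P)" for D P, unfolded fst_conv]\<close>)
  also have "\<dots> = (\<Sum>T\<in>tree_like_tableaux n. real (card (occupied T)) * f (card (occupied T))
           + (real (card (diagram_rows (fst T))) - real (card (occupied T))) * f (Suc (card (occupied T))))"
    by (intro sum.cong refl sum_insert_point_rows) (simp add: tree_like_tableaux_def)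
  finally show ?thesis .
qed

lemma sum_transpose:
  "(\<Sum>T\<in>tree_like_tableaux n. g (transpose_tableau T)) = (\<Sum>T\<in>tree_like_tableaux n. g T)"
  by (rule sum.reindex_bij_witness[where i = transpose_tableau and j = transpose_tableau])
     (auto simp: tree_like_tableaux_def tree_like_tableau_transpose)

lemma card_swap [simp]: "card (prod.swap ` S) = card S"
  by (rule card_image) (rule inj_swap)

lemma card_occupied_transpose [simp]: "card (occupied (transpose_tableau T)) = card (occupied T)"
  by (simp add: occupied_transpose)

lemma diagram_rows_transpose [simp]:
  "diagram_rows (fst (transpose_tableau T)) = diagram_columns (fst T)"
  by (simp add: transpose_tableau_def diagram_rows_def diagram_columns_def image_image)

lemma occupied_not_root:
  assumes "tree_like_tableau n T" "2 \<le> n" "c \<in> occupied T"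
  shows "c \<noteq> (0, 0)"
proof
  assume c: "c = (0, 0)"
  obtain D P where T: "T = (D, P)" by (cases T)
  have D: "finite D" "down_closed D" "half_perimeter D = n + 1" 
    using assms(1) unfolding T tree_like_tableau_iff by auto
  have "(0, 0) \<in> D" "(0, Suc 0) \<notin> D" "(Suc 0, 0) \<notin> D"
    using assms(3) unfolding c T occupied_def by (auto simp: mem_corners_iff)
  hence "D \<subseteq> {(0, 0)}"
    using down_closedD[OF D(2), of _ _ 0 "Suc 0"] down_closedD[OF D(2), of _ _ "Suc 0" 0]
    by (force simp: not_less_eq_eq[symmetric] Suc_le_eq)
  hence "D = {(0, 0)}" using \<open>(0, 0) \<in> D\<close> by blast
  hence "half_perimeter D = 2"
    by (simp add: half_perimeter_def diagram_rows_def diagram_columns_def)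
  thus False using D(3) assms(2) by simp
qed

text \<open>
  Rule (3) says that every occupied corner other than the root is of exactly one of two kinds, which
  are exchanged by transposition.
\<close>

lemma card_occupied_eq:
  assumes T: "tree_like_tableau n T" and n: "2 \<le> n"
  shows "card (occupied T) = card (column_corners T) + card (column_corners (transpose_tableau T))"
proof -
  let ?row = "{c \<in> occupied T. empty_left (snd T) c}"
  have exactly_one: "empty_above (snd T) c \<noteq> empty_left (snd T) c" if c: "c \<in> occupied T" for c
  proof -
    have "c \<in> snd T" "c \<noteq> (0, 0)"
      using c occupied_not_root[OF T n c] by (auto simp: occupied_def)
    thus ?thesis using T by (cases T, cases c) (auto simp: tree_like_tableau_iff)
  qed
  have "occupied T = column_corners T \<union> ?row" "column_corners T \<inter> ?row = {}"
    using exactly_one by (auto simp: column_corners_def)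
  hence "card (occupied T) = card (column_corners T) + card ?row"
    using finite_occupied[OF T] by (metis (lifting) card_Un_disjoint finite_Un)
  also have "column_corners (transpose_tableau T) = prod.swap ` ?row"
    unfolding column_corners_def occupied_transpose
    by (auto simp: transpose_tableau_def empty_above_swap)
  hence "card ?row = card (column_corners (transpose_tableau T))" by simp
  finally show ?thesis .
qed

text \<open>
  Insertions of columns at the rows and of rows at the columns are added up. A function \<open>f\<close> of the
  number of occupied corners is carried along so that the one bijection provides the number of
  tableaux (\<open>f = 1\<close>) as well as all binomial moments.
\<close>

lemma sum_occupied_recurrence:
  fixes f :: "nat \<Rightarrow> real"
  assumes n: "1 \<le> n"
  shows "(\<Sum>T\<in>tree_like_tableaux (Suc n). real (card (occupied T)) * f (card (occupied T)))
       = (\<Sum>T\<in>tree_like_tableaux n. 2 * real (card (occupied T)) * f (card (occupied T))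
           + (real (Suc n) - 2 * real (card (occupied T))) * f (Suc (card (occupied T))))"
proof -
  let ?X = "\<lambda>T. card (occupied T)"
  let ?g = "\<lambda>T. real (?X T) * f (?X T)
           + (real (card (diagram_rows (fst T))) - real (?X T)) * f (Suc (?X T))"
  have "(\<Sum>T\<in>tree_like_tableaux (Suc n). real (?X T) * f (?X T))
      = (\<Sum>T\<in>tree_like_tableaux (Suc n). real (card (column_corners T)) * f (?X T)
          + real (card (column_corners (transpose_tableau T))) * f (?X T))"
    using n by (intro sum.cong refl)
      (simp add: tree_like_tableaux_def card_occupied_eq[of "Suc n"] distrib_right)
  also have "\<dots> = (\<Sum>T\<in>tree_like_tableaux (Suc n). real (card (column_corners T)) * f (?X T))
      + (\<Sum>T\<in>tree_like_tableaux (Suc n). real (card (column_corners (transpose_tableau T)))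
           * f (?X (transpose_tableau T)))"
    by (simp add: sum.distrib)
  also have "\<dots> = (\<Sum>T\<in>tree_like_tableaux n. ?g T) + (\<Sum>T\<in>tree_like_tableaux n. ?g (transpose_tableau T))"
    using sum_transpose[of "\<lambda>T. real (card (column_corners T)) * f (?X T)" "Suc n"]
      sum_transpose[of ?g n] sum_column_corners[OF n, of f] by simp
  also have "\<dots> = (\<Sum>T\<in>tree_like_tableaux n. ?g T + ?g (transpose_tableau T))"
    by (rule sum.distrib[symmetric])
  also have "\<dots> = (\<Sum>T\<in>tree_like_tableaux n. 2 * real (?X T) * f (?X T)
           + (real (Suc n) - 2 * real (?X T)) * f (Suc (?X T)))"
  proof (rule sum.cong[OF refl])
    fix T assume "T \<in> tree_like_tableaux n"
    hence "card (diagram_rows (fst T)) + card (diagram_columns (fst T)) = Suc n"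
      by (cases T) (simp add: tree_like_tableaux_def tree_like_tableau_iff half_perimeter_def)
    hence "real (card (diagram_rows (fst T))) + real (card (diagram_columns (fst T))) = real (Suc n)"
      by (metis of_nat_add)
    thus "?g T + ?g (transpose_tableau T)
        = 2 * real (?X T) * f (?X T) + (real (Suc n) - 2 * real (?X T)) * f (Suc (?X T))"
      by (simp add: algebra_simps flip: distrib_right)
  qed
  finally show ?thesis .
qed

section \<open>Inner corners and the number of tableaux\<close>

text \<open>
  The cells whose addition gives a Ferrers diagram with the same rows and columns; without the
  positivity conditions, the truncated subtraction would admit cells that open a new row or column.
\<close>

definition inner_corners :: "cell set \<Rightarrow> cell set" where
  "inner_corners D = {(i, j). (i, j) \<notin> D \<and> 0 < i \<and> 0 < j \<and> (i - 1, j) \<in> D \<and> (i, j - 1) \<in> D}"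

text \<open>
  Both kinds of corners sit at the descents of the sequence of row lengths: a descent from row \<open>i\<close> to
  row \<open>i + 1\<close> gives a corner in row \<open>i\<close> and an inner corner in row \<open>i + 1\<close>. The exception is the descent
  from the last row to length \<open>0\<close>, which gives a corner only.
\<close>

lemma card_corners_eq_Suc_inner:
  assumes "finite D" "down_closed D" "D \<noteq> {}"
  shows "card (corners D) = Suc (card (inner_corners D))"
    and "finite (inner_corners D)"
proof -
  let ?r = "row_length D"
  have mem: "(i, j) \<in> D \<longleftrightarrow> j < ?r i" for i j
    using assms by (intro mem_iff_less_row_length)
  have anti: "?r i' \<le> ?r i" if "i \<le> i'" for i i'
    using assms that by (intro row_length_antimono)
  define S where "S = {i. ?r (Suc i) < ?r i}"
  define l where "l = Max (diagram_rows D)"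
  have fin: "finite (diagram_rows D)" and ne: "diagram_rows D \<noteq> {}"
    using assms by (auto simp: diagram_rows_def)
  have rows: "diagram_rows D = {i. 0 < ?r i}"
    using diagram_rows_eq[OF assms(2)] mem by simp
  have l: "0 < ?r l" "\<And>i. 0 < ?r i \<Longrightarrow> i \<le> l"
    using Max_in[OF fin ne] Max_ge[OF fin] unfolding l_def rows by auto
  have l_S: "l \<in> S"
    using l(1) l(2)[of "Suc l"] by (cases "?r (Suc l) = 0") (auto simp: S_def)
  have S_sub: "S \<subseteq> diagram_rows D" by (auto simp: S_def rows)
  hence finS: "finite S" using fin finite_subset by blast
  have corners_eq: "corners D = (\<lambda>i. (i, ?r i - 1)) ` S"
  proof (intro set_eqI)
    fix c :: cell
    obtain i j where c: "c = (i, j)" by (cases c)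
    show "c \<in> corners D \<longleftrightarrow> c \<in> (\<lambda>i. (i, ?r i - 1)) ` S"
      unfolding c mem_corners_iff mem image_iff S_def by (auto simp: Bex_def)
  qed
  have inner_eq: "inner_corners D = (\<lambda>i. (Suc i, ?r (Suc i))) ` (S - {l})"
  proof (intro set_eqI)
    fix c :: cell
    obtain i j where c: "c = (i, j)" by (cases c)
    show "c \<in> inner_corners D \<longleftrightarrow> c \<in> (\<lambda>i. (Suc i, ?r (Suc i))) ` (S - {l})"
    proof
      assume "c \<in> inner_corners D"
      then obtain m where m: "i = Suc m" "?r i \<le> j" "0 < j" "j < ?r m" "j - 1 < ?r i"
        unfolding c inner_corners_def mem by (auto simp: gr0_conv_Suc)
      have "m \<in> S - {l}"
        using m l(2)[of "Suc m"] by (auto simp: S_def)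
      moreover have "j = ?r (Suc m)" using m by auto
      ultimately show "c \<in> (\<lambda>i. (Suc i, ?r (Suc i))) ` (S - {l})"
        using m c by auto
    next
      assume "c \<in> (\<lambda>i. (Suc i, ?r (Suc i))) ` (S - {l})"
      then obtain m where m: "m \<in> S" "m \<noteq> l" "i = Suc m" "j = ?r (Suc m)"
        unfolding c by auto
      have "m < l" using m l(2)[of m] by (auto simp: S_def)
      hence "0 < ?r (Suc m)" using l(1) anti[of "Suc m" l] by simp
      thus "c \<in> inner_corners D"
        using m unfolding c inner_corners_def mem by (auto simp: S_def)
    qed
  qed
  have "card (corners D) = card S"
    unfolding corners_eq by (intro card_image inj_onI) auto
  also have "\<dots> = Suc (card (S - {l}))"
    using finS l_S by (metis card.remove)
  also have "card (S - {l}) = card (inner_corners D)"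
    unfolding inner_eq by (rule card_image[symmetric]) (auto intro: inj_onI)
  finally show "card (corners D) = Suc (card (inner_corners D))" .
  show "finite (inner_corners D)" unfolding inner_eq using finS by simp
qed

text \<open>
  The row and the column of an empty corner contain points elsewhere, so they survive the removal of
  the corner.
\<close>

lemma remove_empty_corner:
  assumes T: "tree_like_tableau n (D, P)" and c: "c \<in> corners D" "c \<notin> P"
  shows "tree_like_tableau n (D - {c}, P)" "c \<in> inner_corners (D - {c})"
proof -
  obtain i j where ij: "c = (i, j)" by (cases c)
  note T = T[unfolded tree_like_tableau_iff]
  have mem: "(i, j) \<in> D" "(i, Suc j) \<notin> D" "(Suc i, j) \<notin> D"
    using c(1) unfolding ij mem_corners_iff by auto
  have dc: "(a, b) \<in> D \<Longrightarrow> a' \<le> a \<Longrightarrow> b' \<le> b \<Longrightarrow> (a', b') \<in> D" for a b a' b'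
    using T down_closedD by blast
  have out: "(a, b) = (i, j)" if "(a, b) \<in> D" "i \<le> a" "j \<le> b" for a b
  proof (rule ccontr)
    assume "(a, b) \<noteq> (i, j)"
    hence "Suc i \<le> a \<or> Suc j \<le> b" using that by auto
    thus False using dc[OF that(1), of "Suc i" j] dc[OF that(1), of i "Suc j"] that mem by auto
  qed
  have "(i, 0) \<in> D" "(0, j) \<in> D" using dc[OF mem(1)] by auto
  then obtain i1 j1 where p: "(i, j1) \<in> P" "(i1, j) \<in> P" using T by blast
  hence "(i, j1) \<in> D" "(i1, j) \<in> D" "j1 \<noteq> j" "i1 \<noteq> i" using T c(2) ij by auto
  hence lt: "j1 < j" "i1 < i"
    using out[of i j1] out[of i1 j] by (force intro: not_le_imp_less)+
  have dc': "down_closed (D - {c})"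
    unfolding down_closed_def ij using dc out by blast
  have "diagram_rows (D - {c}) = diagram_rows D" "diagram_columns (D - {c}) = diagram_columns D"
    using T lt unfolding ij by (simp_all add: diagram_rows_eq diagram_columns_eq dc'[unfolded ij])
  hence "half_perimeter (D - {c}) = n + 1"
    using T by (simp add: half_perimeter_def)
  moreover have "finite (D - {c})" "P \<subseteq> D - {c}"
    using T c(2) by auto
  ultimately show "tree_like_tableau n (D - {c}, P)"
    unfolding tree_like_tableau_iff using T dc' by simp
  show "c \<in> inner_corners (D - {c})"
    using lt dc[OF mem(1), of "i - 1" j] dc[OF mem(1), of i "j - 1"] 
    unfolding ij inner_corners_def by auto
qed

lemma add_empty_corner:
  assumes T: "tree_like_tableau n (D, P)" and c: "c \<in> inner_corners D"
  shows "tree_like_tableau n (insert c D, P)" "c \<in> corners (insert c D) - P"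
proof -
  obtain i j where ij: "c = (i, j)" by (cases c)
  note T = T[unfolded tree_like_tableau_iff]
  have mem: "(i, j) \<notin> D" "0 < i" "0 < j" "(i - 1, j) \<in> D" "(i, j - 1) \<in> D"
    using c unfolding ij inner_corners_def by auto
  have dc: "(a, b) \<in> D \<Longrightarrow> a' \<le> a \<Longrightarrow> b' \<le> b \<Longrightarrow> (a', b') \<in> D" for a b a' b'
    using T down_closedD by blast
  have below: "(a, b) \<in> insert (i, j) D" if le: "a \<le> i" "b \<le> j" for a b
  proof -
    consider "a = i \<and> b = j" | "a \<le> i - 1" | "b \<le> j - 1" using le mem(2,3) by linarith
    thus ?thesis
      by cases (use dc[OF mem(4) _ le(2)] dc[OF mem(5) le(1)] in simp_all)
  qed
  have dc': "down_closed (insert c D)"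
    unfolding down_closed_def ij using dc below by blast
  have "(i, 0) \<in> D" "(0, j) \<in> D" using below[of i 0] below[of 0 j] mem by auto
  hence "diagram_rows (insert c D) = diagram_rows D" "diagram_columns (insert c D) = diagram_columns D"
    using T mem(2,3) dc' unfolding ij by (simp_all add: diagram_rows_eq diagram_columns_eq)
  hence "half_perimeter (insert c D) = n + 1"
    using T by (simp add: half_perimeter_def)
  moreover have "finite (insert c D)" "P \<subseteq> insert c D"
    using T by auto
  moreover have "(a, 0) \<in> insert c D \<longleftrightarrow> (a, 0) \<in> D" "(0, a) \<in> insert c D \<longleftrightarrow> (0, a) \<in> D" for a
    using mem ij by auto
  ultimately show "tree_like_tableau n (insert c D, P)"
    unfolding tree_like_tableau_iff using T dc' by simp
  show "c \<in> corners (insert c D) - P"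
  proof -
    have "(i, Suc j) \<notin> D" "(Suc i, j) \<notin> D"
      using mem(1) dc[of i "Suc j" i j] dc[of "Suc i" j i j] by auto
    moreover have "c \<notin> P" using T mem(1) ij by blast
    ultimately show ?thesis by (simp add: ij mem_corners_iff)
  qed
qed

text \<open>
  An inner corner becomes an empty corner when its cell is added to the diagram, and removing the cell
  undoes this.
\<close>

lemma sum_empty_corners_eq_sum_inner_corners:
  "(\<Sum>T\<in>tree_like_tableaux n. card (corners (fst T) - snd T))
     = (\<Sum>T\<in>tree_like_tableaux n. card (inner_corners (fst T)))"
proof -
  have fin: "finite (corners (fst T) - snd T) \<and> finite (inner_corners (fst T))"
    if "tree_like_tableau n T" for T
  proof -
    obtain D P where T: "T = (D, P)" by (cases T)
    have "finite D" "down_closed D" "D \<noteq> {}" using that unfolding T tree_like_tableau_iff by auto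
    thus ?thesis using card_corners_eq_Suc_inner(2) by (auto simp: T corners_def)
  qed
  let ?rem = "\<lambda>(T, c). ((fst T - {c}, snd T), c) :: tableau \<times> cell"
  let ?add = "\<lambda>(T, c). ((insert c (fst T), snd T), c) :: tableau \<times> cell"
  have "card (SIGMA T:tree_like_tableaux n. corners (fst T) - snd T)
      = card (SIGMA T:tree_like_tableaux n. inner_corners (fst T))"
  proof (rule bij_betw_same_card[OF bij_betw_byWitness[where f = ?rem and f' = ?add]])
    show "\<forall>x\<in>SIGMA T:tree_like_tableaux n. corners (fst T) - snd T. ?add (?rem x) = x"
      by (auto simp: corners_def)
    show "\<forall>x\<in>SIGMA T:tree_like_tableaux n. inner_corners (fst T). ?rem (?add x) = x"
      by (auto simp: inner_corners_def)
    show "?rem ` (SIGMA T:tree_like_tableaux n. corners (fst T) - snd T)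
        \<subseteq> (SIGMA T:tree_like_tableaux n. inner_corners (fst T))"
      by (auto simp: tree_like_tableaux_def dest: remove_empty_corner)
    show "?add ` (SIGMA T:tree_like_tableaux n. inner_corners (fst T))
        \<subseteq> (SIGMA T:tree_like_tableaux n. corners (fst T) - snd T)"
      by (auto simp: tree_like_tableaux_def dest: add_empty_corner)
  qed
  thus ?thesis
    using fin by (subst (asm) (1 2) card_SigmaI)
      (auto simp: finite_tree_like_tableaux, simp_all add: tree_like_tableaux_def)
qed

text \<open>
  A tableau has one corner more than it has inner corners, and on average as many empty corners as
  inner corners; so on average it has one occupied corner.
\<close>

lemma sum_occupied_eq_card:
  "(\<Sum>T\<in>tree_like_tableaux n. card (occupied T)) = card (tree_like_tableaux n)"
proof -
  have split: "card (occupied T) + card (corners (fst T) - snd T) = Suc (card (inner_corners (fst T)))"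
    if "T \<in> tree_like_tableaux n" for T
  proof -
    obtain D P where T: "T = (D, P)" by (cases T)
    have D: "finite D" "down_closed D" "D \<noteq> {}"
      using that unfolding T tree_like_tableaux_def mem_Collect_eq tree_like_tableau_iff by auto
    have "finite (corners D)" using D(1) by (simp add: corners_def)
    hence "card (corners D \<inter> P) + card (corners D - P) = card (corners D)"
      by (rule card_Int_Diff[symmetric])
    thus ?thesis using card_corners_eq_Suc_inner(1)[OF D] by (simp add: T occupied_def)
  qed
  have "(\<Sum>T\<in>tree_like_tableaux n. card (occupied T))
          + (\<Sum>T\<in>tree_like_tableaux n. card (corners (fst T) - snd T))
      = (\<Sum>T\<in>tree_like_tableaux n. Suc (card (inner_corners (fst T))))"
    by (simp add: sum.distrib[symmetric] split)
  also have "\<dots> = (\<Sum>T\<in>tree_like_tableaux n. card (inner_corners (fst T))) + card (tree_like_tableaux n)"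
    by (simp add: sum_Suc)
  finally show ?thesis
    using sum_empty_corners_eq_sum_inner_corners[of n] by simp
qed

text \<open>
  The recursion computes the sum of the numbers of occupied corners in another way, namely as
  \<open>n + 1\<close> for each tableau of size \<open>n\<close>.
\<close>

lemma card_tree_like_tableaux_Suc:
  assumes "1 \<le> n"
  shows "card (tree_like_tableaux (Suc n)) = Suc n * card (tree_like_tableaux n)"
proof -
  have "real (card (tree_like_tableaux (Suc n))) = (\<Sum>T\<in>tree_like_tableaux (Suc n). real (card (occupied T)))"
    unfolding sum_occupied_eq_card[of "Suc n", symmetric] by simp
  also have "\<dots> = real (Suc n) * real (card (tree_like_tableaux n))"
    using sum_occupied_recurrence[OF assms, of "\<lambda>_. 1"] by simp
  finally show ?thesis by (metis of_nat_eq_iff of_nat_mult)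
qed

section \<open>Binomial moments\<close>

definition binomial_moment :: "nat \<Rightarrow> nat \<Rightarrow> real" where
  "binomial_moment n k = (\<Sum>T\<in>tree_like_tableaux n. real (card (occupied T) choose k))
     / real (card (tree_like_tableaux n))"

lemma card_tree_like_tableaux_pos: "1 \<le> n \<Longrightarrow> 0 < card (tree_like_tableaux n)"
  using tree_like_tableaux_nonempty finite_tree_like_tableaux by (simp add: card_gt_0_iff)

lemma binomial_moment_0: "1 \<le> n \<Longrightarrow> binomial_moment n 0 = 1"
  using card_tree_like_tableaux_pos[of n] by (simp add: binomial_moment_def)

lemma binomial_moment_nonneg: "0 \<le> binomial_moment n k"
  by (simp add: binomial_moment_def sum_nonneg)

text \<open>
  The recursion with \<open>f x = (x - 1 choose k)\<close>. On the left, \<open>x (x - 1 choose k) = (k + 1) (x choose k + 1)\<close>;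
  on the right, \<open>x (x - 1 choose k) = (x - k) (x choose k)\<close>, so that \<open>x\<close> cancels from the coefficient of
  \<open>(x choose k)\<close>.
\<close>

lemma binomial_moment_Suc:
  assumes n: "1 \<le> n"
  shows "binomial_moment (Suc n) (Suc k)
       = (real (Suc n) - 2 * real k) / (real (Suc n) * real (Suc k)) * binomial_moment n k"
proof -
  let ?X = "\<lambda>T. card (occupied T)"
  have absorb: "real (Suc k) * real (x choose Suc k) = real x * real ((x - 1) choose k)" for x
  proof (cases x)
    case (Suc y)
    thus ?thesis
      using Suc_times_binomial_eq[of y k] by (metis diff_Suc_1 mult.commute of_nat_mult)
  qed simp
  have step: "2 * real x * real ((x - 1) choose k) + (real (Suc n) - 2 * real x) * real (x choose k)
      = (real (Suc n) - 2 * real k) * real (x choose k)" for x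
  proof -
    have "real x * real (x choose k) = real x * real ((x - 1) choose k) + real k * real (x choose k)"
    proof (cases "x = 0 \<or> k = 0")
      case True
      thus ?thesis by (cases k) auto
    next
      case False
      then obtain y l where xl: "x = Suc y" "k = Suc l" by (meson not0_implies_Suc)
      have "real k * real (x choose k) = real x * real (y choose l)"
        using Suc_times_binomial_eq[of y l] xl by (metis mult.commute of_nat_mult)
      thus ?thesis by (simp add: xl algebra_simps)
    qed
    thus ?thesis by (simp add: algebra_simps)
  qed
  have "real (Suc k) * (\<Sum>T\<in>tree_like_tableaux (Suc n). real (?X T choose Suc k))
      = (\<Sum>T\<in>tree_like_tableaux (Suc n). real (?X T) * real ((?X T - 1) choose k))"
    by (simp only: sum_distrib_left absorb)
  also have "\<dots> = (\<Sum>T\<in>tree_like_tableaux n. 2 * real (?X T) * real ((?X T - 1) choose k)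
           + (real (Suc n) - 2 * real (?X T)) * real (?X T choose k))"
    using sum_occupied_recurrence[OF n, of "\<lambda>x. real ((x - 1) choose k)"] by simp
  also have "\<dots> = (real (Suc n) - 2 * real k) * (\<Sum>T\<in>tree_like_tableaux n. real (?X T choose k))"
    by (simp only: step sum_distrib_left)
  finally show ?thesis
    using card_tree_like_tableaux_pos[OF n]
    unfolding binomial_moment_def card_tree_like_tableaux_Suc[OF n] of_nat_mult
    by (simp add: divide_simps del: of_nat_Suc) (simp add: mult_ac del: of_nat_Suc)
qed

text \<open>
  The factor in the recursion is at most \<open>1 / (k + 1)\<close>. The recursion starts at size \<open>1\<close>, where there is
  at most one occupied corner because the half-perimeter is \<open>2\<close>.
\<close>

lemma binomial_moment_le: "1 \<le> n \<Longrightarrow> binomial_moment n k \<le> 1 / fact k"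
proof (induction k arbitrary: n)
  case 0
  thus ?case by (simp add: binomial_moment_0)
next
  case (Suc k)
  show ?case
  proof (cases "n = 1")
    case True
    have "card (occupied T) \<le> 1" if "T \<in> tree_like_tableaux 1" for T
    proof -
      have T: "tree_like_tableau 1 T" using that by (simp add: tree_like_tableaux_def)
      have "card (diagram_rows (fst T)) + card (diagram_columns (fst T)) = 2"
        using T by (cases T) (simp add: tree_like_tableau_iff half_perimeter_def)
      thus ?thesis
        using occupied_rows(3)[OF T] occupied_rows(3)[OF tree_like_tableau_transpose[OF T]] by simp
    qed
    moreover have "real (x choose Suc k) \<le> 1 / fact (Suc k)" if "x \<le> 1" for x
    proof (cases "x = 1 \<and> k = 0")
      case False
      hence "x choose Suc k = 0" using that by (intro binomial_eq_0) auto
      show ?thesis unfolding \<open>x choose Suc k = 0\<close> by simp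
    qed simp
    ultimately have le: "real (card (occupied T) choose Suc k) \<le> 1 / fact (Suc k)"
      if "T \<in> tree_like_tableaux 1" for T
      using that by blast
    have "(\<Sum>T\<in>tree_like_tableaux 1. real (card (occupied T) choose Suc k))
        \<le> real (card (tree_like_tableaux 1)) * (1 / fact (Suc k))"
      by (rule sum_bounded_above) (rule le)
    thus ?thesis
      using card_tree_like_tableaux_pos[of 1] unfolding True binomial_moment_def
      by (simp add: divide_le_eq mult.commute)
  next
    case False
    then obtain m where m: "n = Suc m" "1 \<le> m" using Suc.prems by (cases n) auto
    have "(real (Suc m) - 2 * real k) / (real (Suc m) * real (Suc k)) \<le> 1 / real (Suc k)"
      by (simp add: divide_simps)
    hence "binomial_moment n (Suc k) \<le> 1 / real (Suc k) * binomial_moment m k"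
      unfolding m(1) binomial_moment_Suc[OF m(2)] by (rule mult_right_mono) (rule binomial_moment_nonneg)
    also have "\<dots> \<le> 1 / real (Suc k) * (1 / fact k)"
      by (rule mult_left_mono[OF Suc.IH[OF m(2)]]) simp
    finally show ?thesis by (simp add: field_simps)
  qed
qed

lemma binomial_moment_tendsto: "(\<lambda>n. binomial_moment n k) \<longlonglongrightarrow> 1 / fact k"
proof (induction k)
  case 0
  have "eventually (\<lambda>n. 1 = binomial_moment n 0) sequentially"
    using eventually_ge_at_top[of 1] by eventually_elim (simp add: binomial_moment_0)
  from Lim_transform_eventually[OF tendsto_const this] show ?case by simp
next
  case (Suc k)
  have "(\<lambda>n. (1 - 2 * real k * inverse (real (Suc n))) / real (Suc k) * binomial_moment n k)
      \<longlonglongrightarrow> (1 - 2 * real k * 0) / real (Suc k) * (1 / fact k)"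
    by (intro tendsto_mult tendsto_divide tendsto_diff tendsto_const Suc.IH
          LIMSEQ_inverse_real_of_nat) simp
  moreover have "eventually (\<lambda>n. (1 - 2 * real k * inverse (real (Suc n))) / real (Suc k) * binomial_moment n k
      = binomial_moment (Suc n) (Suc k)) sequentially"
    using eventually_ge_at_top[of 1]
    by eventually_elim (simp add: binomial_moment_Suc divide_simps del: of_nat_Suc)
  ultimately have "(\<lambda>n. binomial_moment (Suc n) (Suc k)) \<longlonglongrightarrow> 1 / fact (Suc k)"
    by (auto dest: Lim_transform_eventually simp: mult_ac)
  thus ?case by (rule LIMSEQ_imp_Suc)
qed

section \<open>Poisson limits from binomial moments\<close>

text \<open>
  Inclusion-exclusion for a set of \<open>x\<close> events that all occur: since
  \<open>(k + i choose k) (x choose k + i) = (x choose k) (x - k choose i)\<close>, the sum is \<open>(x choose k)\<close> times the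
  alternating row sum of the binomial coefficients of \<open>x - k\<close>, which vanishes unless \<open>x = k\<close>.
\<close>

lemma alternating_binomial_moments_indicator:
  fixes x k N :: nat
  assumes "x \<le> N"
  shows "(\<Sum>i\<le>N. (-1) ^ i * real ((k + i) choose k) * real (x choose (k + i)))
       = (if x = k then 1 else 0)"
proof (cases "k \<le> x")
  case False
  thus ?thesis by (simp add: binomial_eq_0)
next
  case True
  have "(\<Sum>i\<le>N. (-1) ^ i * real ((k + i) choose k) * real (x choose (k + i)))
      = (\<Sum>i\<le>x - k. (-1) ^ i * real ((k + i) choose k) * real (x choose (k + i)))"
    using assms True by (intro sum.mono_neutral_right) (auto simp: binomial_eq_0)
  also have "\<dots> = (\<Sum>i\<le>x - k. real (x choose k) * ((-1) ^ i * real ((x - k) choose i)))"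
  proof (rule sum.cong[OF refl])
    fix i assume "i \<in> {..x - k}"
    hence "(x choose (k + i)) * ((k + i) choose k) = (x choose k) * ((x - k) choose i)"
      using choose_mult[of k "k + i" x] True by simp
    hence "real ((k + i) choose k) * real (x choose (k + i))
         = real (x choose k) * real ((x - k) choose i)"
      by (metis mult.commute of_nat_mult)
    thus "(-1) ^ i * real ((k + i) choose k) * real (x choose (k + i))
        = real (x choose k) * ((-1) ^ i * real ((x - k) choose i))"
      by (simp add: mult.assoc mult.left_commute)
  qed
  also have "\<dots> = real (x choose k) * (\<Sum>i\<le>x - k. (-1) ^ i * real ((x - k) choose i))"
    by (simp add: sum_distrib_left)
  also have "\<dots> = (if x = k then 1 else 0)"
    using choose_alternating_sum[of "x - k", where ?'a = real] True by auto
  finally show ?thesis .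
qed

lemma pmf_eq_alternating_binomial_moments:
  fixes p :: "nat pmf"
  assumes fin: "finite (set_pmf p)"
  shows "pmf p k = (\<Sum>i. (-1) ^ i * real ((k + i) choose k)
           * measure_pmf.expectation p (\<lambda>x. real (x choose (k + i))))"
proof -
  obtain N where N: "\<And>x. x \<in> set_pmf p \<Longrightarrow> x \<le> N"
    using fin by (meson finite_nat_set_iff_bounded_le)
  have E: "measure_pmf.expectation p f = (\<Sum>x\<in>set_pmf p. pmf p x * f x)" for f :: "nat \<Rightarrow> real"
    using integral_measure_pmf[OF fin, of p f] by simp
  have "(\<Sum>i. (-1) ^ i * real ((k + i) choose k)
           * measure_pmf.expectation p (\<lambda>x. real (x choose (k + i))))
      = (\<Sum>i\<le>N. (-1) ^ i * real ((k + i) choose k)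
           * measure_pmf.expectation p (\<lambda>x. real (x choose (k + i))))"
  proof (rule suminf_finite)
    fix i assume "i \<notin> {..N}"
    hence "x choose (k + i) = 0" if "x \<in> set_pmf p" for x
      using N[OF that] by (intro binomial_eq_0) auto
    hence "(\<Sum>x\<in>set_pmf p. pmf p x * real (x choose (k + i))) = 0"
      by (intro sum.neutral) auto
    thus "(-1) ^ i * real ((k + i) choose k)
           * measure_pmf.expectation p (\<lambda>x. real (x choose (k + i))) = 0"
      by (simp add: E)
  qed simp
  also have "\<dots> = (\<Sum>x\<in>set_pmf p. pmf p x *
      (\<Sum>i\<le>N. (-1) ^ i * real ((k + i) choose k) * real (x choose (k + i))))"
    unfolding E sum_distrib_left by (subst sum.swap) (simp add: mult_ac)
  also have "\<dots> = (\<Sum>x\<in>set_pmf p. pmf p x * (if x = k then 1 else 0))"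
    by (intro sum.cong refl arg_cong2[where f = "(*)"] alternating_binomial_moments_indicator N)
  also have "\<dots> = (\<Sum>x\<in>set_pmf p. if x = k then pmf p k else 0)"
    by (intro sum.cong) auto
  also have "\<dots> = pmf p k"
    using fin by (auto simp: set_pmf_iff)
  finally show ?thesis ..
qed

text \<open>
  The numbers \<open>r\<^sup>j / j!\<close> are the binomial moments of the Poisson distribution with parameter \<open>r\<close>.
  With them as a uniform bound, the \<open>i\<close>-th term of the inclusion-exclusion series is at most
  \<open>r\<^sup>k / k! * r\<^sup>i / i!\<close> in absolute value, so Tannery's theorem applies.
\<close>

lemma binomial_moments_imp_poisson_limit:
  fixes p :: "nat \<Rightarrow> nat pmf" and r :: real
  assumes fin: "eventually (\<lambda>n. finite (set_pmf (p n))) sequentially"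
    and lim: "\<And>j. (\<lambda>n. measure_pmf.expectation (p n) (\<lambda>x. real (x choose j)))
                   \<longlonglongrightarrow> r ^ j / fact j"
    and bound: "eventually (\<lambda>n. \<forall>j. measure_pmf.expectation (p n) (\<lambda>x. real (x choose j))
                   \<le> r ^ j / fact j) sequentially"
  shows "(\<lambda>n. pmf (p n) k) \<longlonglongrightarrow> r ^ k / fact k * exp (- r)"
proof -
  define a where "a = (\<lambda>i n. (-1) ^ i * real ((k + i) choose k)
           * measure_pmf.expectation (p n) (\<lambda>x. real (x choose (k + i))))"
  define b where "b = (\<lambda>i. r ^ k / fact k * ((- r) ^ i / fact i))"
  define M where "M = (\<lambda>i. r ^ k / fact k * (r ^ i / fact i))"
  have coeff: "real ((k + i) choose k) * (r ^ (k + i) / fact (k + i))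
             = r ^ k / fact k * (r ^ i / fact i)" for i
    by (simp add: binomial_fact power_add)
  have lim_a: "(\<lambda>n. a i n) \<longlonglongrightarrow> b i" for i
  proof -
    have "(\<lambda>n. a i n) \<longlonglongrightarrow> (-1) ^ i * real ((k + i) choose k) * (r ^ (k + i) / fact (k + i))"
      unfolding a_def by (intro tendsto_mult tendsto_const lim)
    also have "(-1) ^ i * real ((k + i) choose k) * (r ^ (k + i) / fact (k + i)) = b i"
      unfolding b_def mult.assoc coeff by (simp add: power_minus[of r i])
    finally show ?thesis .
  qed
  have "eventually (\<lambda>(i, n). norm (a i n) \<le> M i) (at_top \<times>\<^sub>F sequentially)"
  proof -
    have "eventually (\<lambda>n. \<forall>i. norm (a i n) \<le> M i) sequentially"
      using bound
    proof eventually_elim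
      case (elim n)
      show ?case
      proof
        fix i
        let ?m = "measure_pmf.expectation (p n) (\<lambda>x. real (x choose (k + i)))"
        have "norm (a i n) = real ((k + i) choose k) * ?m"
          by (simp add: a_def abs_mult)
        also have "\<dots> \<le> real ((k + i) choose k) * (r ^ (k + i) / fact (k + i))"
          using elim by (intro mult_left_mono) auto
        finally show "norm (a i n) \<le> M i" unfolding coeff M_def .
      qed
    qed
    hence "eventually (\<lambda>y. \<forall>i. norm (a i (snd y)) \<le> M i) (at_top \<times>\<^sub>F sequentially)"
      by (rule eventually_compose_filterlim[OF _ filterlim_snd])
    thus ?thesis by (rule eventually_mono) auto
  qed
  moreover have "summable M"
    unfolding M_def using summable_exp[of r] by (intro summable_mult) (simp add: field_simps)
  ultimately have "(\<lambda>n. \<Sum>i. a i n) \<longlonglongrightarrow> (\<Sum>i. b i)"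
    using tannerys_theorem[of a b sequentially M] lim_a by simp
  also have "(\<Sum>i. b i) = r ^ k / fact k * exp (- r)"
    unfolding b_def exp_def using summable_exp_generic[of "- r"]
    by (subst suminf_mult) (simp_all add: field_simps)
  finally show ?thesis
    by (rule Lim_transform_eventually)
       (use fin in eventually_elim, simp add: pmf_eq_alternating_binomial_moments a_def)
qed

lemma cdf_real_nat_pmf:
  fixes p :: "nat pmf"
  shows "cdf (distr (measure_pmf p) borel real) x = (\<Sum>k | real k \<le> x. pmf p k)"
proof -
  have fin: "finite {k. real k \<le> x}"
    by (rule finite_subset[of _ "{..nat \<lfloor>x\<rfloor>}"]) (auto simp: le_nat_floor)
  have "cdf (distr (measure_pmf p) borel real) x = measure_pmf.prob p {k. real k \<le> x}"
    by (simp add: cdf_def measure_distr vimage_def)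
  thus ?thesis using fin by (simp add: measure_measure_pmf_finite)
qed

text \<open>
  The distribution function at a point is a finite sum of probabilities, so it converges everywhere,
  not only at the continuity points of the limit.
\<close>

lemma weak_conv_m_nat_pmf:
  fixes p :: "nat \<Rightarrow> nat pmf"
  assumes "\<And>k. (\<lambda>n. pmf (p n) k) \<longlonglongrightarrow> pmf q k"
  shows "weak_conv_m (\<lambda>n. distr (measure_pmf (p n)) borel real) (distr (measure_pmf q) borel real)"
  unfolding weak_conv_m_def weak_conv_def cdf_real_nat_pmf
  using assms by (auto intro: tendsto_sum)

section \<open>Convergence to the Poisson distribution\<close>

lemma expectation_choose_occupied_corners:
  assumes "1 \<le> n"
  shows "measure_pmf.expectation (map_pmf occupied_corners (random_tlt n)) (\<lambda>x. real (x choose k))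
       = binomial_moment n k"
  using tree_like_tableaux_nonempty[OF assms] finite_tree_like_tableaux[of n]
  by (simp add: random_tlt_def integral_pmf_of_set binomial_moment_def occupied_corners_def occupied_def)

lemma pmf_occupied_corners_tendsto:
  "(\<lambda>n. pmf (map_pmf occupied_corners (random_tlt n)) k) \<longlonglongrightarrow> exp (- 1) / fact k"
proof -
  let ?p = "\<lambda>n. map_pmf occupied_corners (random_tlt n)"
  have ge1: "eventually (\<lambda>n. 1 \<le> n) sequentially" by (rule eventually_ge_at_top)
  have "(\<lambda>n. pmf (?p n) k) \<longlonglongrightarrow> 1 ^ k / fact k * exp (- 1)"
  proof (rule binomial_moments_imp_poisson_limit)
    show "eventually (\<lambda>n. finite (set_pmf (?p n))) sequentially"
      using ge1 by eventually_elim
        (simp add: random_tlt_def tree_like_tableaux_nonempty finite_tree_like_tableaux)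
    show "(\<lambda>n. measure_pmf.expectation (?p n) (\<lambda>x. real (x choose j))) \<longlonglongrightarrow> 1 ^ j / fact j" for j
    proof -
      have "eventually (\<lambda>n. binomial_moment n j
          = measure_pmf.expectation (?p n) (\<lambda>x. real (x choose j))) sequentially"
        using ge1 by eventually_elim (rule expectation_choose_occupied_corners[symmetric])
      thus ?thesis
        unfolding power_one by (rule Lim_transform_eventually[OF binomial_moment_tendsto])
    qed
    show "eventually (\<lambda>n. \<forall>j. measure_pmf.expectation (?p n) (\<lambda>x. real (x choose j)) \<le> 1 ^ j / fact j)
        sequentially"
      using ge1 by eventually_elim
        (simp only: expectation_choose_occupied_corners binomial_moment_le power_one simp_thms)
  qed
  thus ?thesis by simp
qed

theorem corollary2:
  shows "weak_conv_m
           (\<lambda>n. distr (measure_pmf (random_tlt n)) borel (\<lambda>T. real (occupied_corners T)))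
           (distr (measure_pmf (poisson_pmf 1)) borel real)
       \<and> (\<forall>k::nat. (\<lambda>n. measure_pmf.prob (random_tlt n) {T. occupied_corners T = k})
             \<longlonglongrightarrow> exp (- 1) / fact k)"
proof
  let ?p = "\<lambda>n. map_pmf occupied_corners (random_tlt n)"
  have "weak_conv_m (\<lambda>n. distr (measure_pmf (?p n)) borel real)
          (distr (measure_pmf (poisson_pmf 1)) borel real)"
    using pmf_occupied_corners_tendsto by (intro weak_conv_m_nat_pmf) simp
  moreover have "distr (measure_pmf (?p n)) borel real
      = distr (measure_pmf (random_tlt n)) borel (\<lambda>T. real (occupied_corners T))" for n
    by (simp add: map_pmf_rep_eq distr_distr comp_def)
  ultimately show "weak_conv_m
           (\<lambda>n. distr (measure_pmf (random_tlt n)) borel (\<lambda>T. real (occupied_corners T)))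
           (distr (measure_pmf (poisson_pmf 1)) borel real)" by simp
  show "\<forall>k. (\<lambda>n. measure_pmf.prob (random_tlt n) {T. occupied_corners T = k})
             \<longlonglongrightarrow> exp (- 1) / fact k"
    using pmf_occupied_corners_tendsto by (simp add: pmf_map vimage_def)
qed

end
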